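(* There is an algorithm which, given integers $m\ge 1$ and $k \ge 1$, generates a multiversal cycle for the unlabeled binary words $U(m)$ of multiplicity $r = km$ and takes amortized $\mathcal{O}(1)$-time to generate each bit.
   Context: Let $B(m)$ be the set of binary words of length $m$, and for $w\in B(m)$ let $\overline{w}$ be its bitwise complement. $U(m)$ denotes any set containing exactly one representative of each of the $2^{m-1}$ pairs $\{w,\overline{w}\}$. A multiversal cycle of $U(m)$ of multiplicity $r$ is a binary sequence $S = s_0 s_1\cdots s_{|S|-1}$ (indices modulo $|S|$) with $|S| = r\cdot 2^{m-1}$ such that for every $0 \le j < r$ the set of words $\{\, s_{j+tr}\, s_{j+tr+1}\cdots s_{j+tr+m-1} : 0 \le t < 2^{m-1} \,\}$ contains exactly one word from each pair $\{w,\overline{w}\}$, $w\in B(m)$. Generating $S$ means outputting its bits $s_0,s_1,\ldots$ one after another; amortized $\mathcal{O}(1)$-time per bit means that the total running time is $\mathcal{O}(|S|)$, in the unit-cost RAM model. *)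

theory Defs
  imports Main
begin

section \<open>Unlabeled binary words and multiversal cycles\<close>

definition binary_words :: "nat \<Rightarrow> bool list set" where
  "binary_words m = {w. length w = m}"

definition bitwise_complement :: "bool list \<Rightarrow> bool list" where
  "bitwise_complement w = map Not w"

definition unlabeled_representatives :: "nat \<Rightarrow> bool list set \<Rightarrow> bool" where
  "unlabeled_representatives m U \<longleftrightarrow>
     U \<subseteq> binary_words m \<and>
     (\<forall>w \<in> binary_words m. card (U \<inter> {w, bitwise_complement w}) = 1)"

definition cyclic_window :: "bool list \<Rightarrow> nat \<Rightarrow> nat \<Rightarrow> bool list" where
  "cyclic_window S p m = map (\<lambda>i. S ! ((p + i) mod length S)) [0..<m]"

definition multiversal_cycle :: "nat \<Rightarrow> nat \<Rightarrow> bool list \<Rightarrow> bool" where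
  "multiversal_cycle m r S \<longleftrightarrow>
     length S = r * 2 ^ (m - 1) \<and>
     (\<forall>j < r. unlabeled_representatives m
        ((\<lambda>t. cyclic_window S (j + t * r) m) ` {t. t < 2 ^ (m - 1)}))"


section \<open>Unit-cost random access machine\<close>

text \<open>
  A random access machine in the style of Cook and Reckhow, with infinitely many registers holding
  natural numbers.  The arithmetic is addition and truncated subtraction only: unit-cost
  multiplication on unbounded registers would make the model unrealistically powerful.
  The operands of all instructions are register indices, except for the second argument of
  \<open>Const\<close> (a literal) and of \<open>JumpZero\<close> (a program address).
\<close>

datatype instr =
    Const nat nat
  | Add nat nat nat
  | Sub nat nat nat
  | Load nat nat
  | Store nat nat
  | JumpZero nat nat
  | Write nat

type_synonym program = "instr list"

text \<open>Program counter, register contents, and the values written so far, oldest first.\<close>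

type_synonym configuration = "nat \<times> (nat \<Rightarrow> nat) \<times> nat list"

fun execute :: "instr \<Rightarrow> configuration \<Rightarrow> configuration" where
  "execute (Const d n) (pc, R, out) = (Suc pc, R(d := n), out)"
| "execute (Add d a b) (pc, R, out) = (Suc pc, R(d := R a + R b), out)"
| "execute (Sub d a b) (pc, R, out) = (Suc pc, R(d := R a - R b), out)"
| "execute (Load d a) (pc, R, out) = (Suc pc, R(d := R (R a)), out)"
| "execute (Store a s) (pc, R, out) = (Suc pc, R(R a := R s), out)"
| "execute (JumpZero a l) (pc, R, out) = (if R a = 0 then l else Suc pc, R, out)"
| "execute (Write a) (pc, R, out) = (Suc pc, R, out @ [R a])"

text \<open>
  The machine halts when the program counter leaves the program.  A halted configuration has no
  successor, so the number of steps leading to it is the running time.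
\<close>

definition halted :: "program \<Rightarrow> configuration \<Rightarrow> bool" where
  "halted P c \<longleftrightarrow> length P \<le> fst c"

definition step :: "program \<Rightarrow> configuration \<Rightarrow> configuration \<Rightarrow> bool" where
  "step P c c' \<longleftrightarrow> \<not> halted P c \<and> c' = execute (P ! fst c) c"

definition initial :: "nat list \<Rightarrow> configuration" where
  "initial xs = (0, \<lambda>i. if i < length xs then xs ! i else 0, [])"

definition computes_in :: "program \<Rightarrow> nat list \<Rightarrow> nat list \<Rightarrow> nat \<Rightarrow> bool" where
  "computes_in P xs ys T \<longleftrightarrow>
     (\<exists>pc R. (step P ^^ T) (initial xs) (pc, R, ys) \<and> halted P (pc, R, ys))"

text \<open>Bits are written as the numbers 0 and 1, one per \<open>Write\<close> instruction.\<close>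

definition generates_in :: "program \<Rightarrow> nat list \<Rightarrow> bool list \<Rightarrow> nat \<Rightarrow> bool" where
  "generates_in P xs S T \<longleftrightarrow> computes_in P xs (map of_bool S) T"

end

theory Submission
  imports Defs
begin

text \<open>
  Write every \<open>t < 2 ^ (m - 1)\<close> as an \<open>m\<close>-bit word, least significant bit first, and output \<open>k\<close>
  copies of the word of \<open>0\<close>, then \<open>k\<close> copies of the word of \<open>1\<close>, and so on.  The windows at a fixed
  position \<open>j\<close> modulo \<open>k * m\<close> consist of the bits of \<open>t\<close> from \<open>i = j mod m\<close> on, followed by the \<open>i\<close>
  low bits of \<open>t\<close> (inside a block of copies) or of \<open>t + 1\<close> (at the end of a block).  Either way they
  determine \<open>t\<close>, and the vanishing top bit of \<open>t\<close> always appears at position \<open>m - 1 - i\<close>; hence the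
  windows are exactly the words with a \<open>0\<close> there.  The generator keeps \<open>t\<close> as an array of bits.
  Incrementing it takes \<open>O(m)\<close> steps, which the \<open>k * m\<close> output bits of each block pay for.
\<close>

section \<open>The cycle\<close>

definition bits_of :: "nat \<Rightarrow> nat \<Rightarrow> bool list" where
  "bits_of m t = map (bit t) [0..<m]"

definition block :: "nat \<Rightarrow> nat \<Rightarrow> nat \<Rightarrow> bool list" where
  "block m k t = concat (replicate k (bits_of m t))"

definition counting_cycle :: "nat \<Rightarrow> nat \<Rightarrow> bool list" where
  "counting_cycle m k = concat (map (block m k) [0..<2 ^ (m - 1)])"

lemma length_concat_uniform:
  assumes "\<And>xs. xs \<in> set xss \<Longrightarrow> length xs = n"
  shows "length (concat xss) = length xss * n"
  using assms by (induction xss) auto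

lemma nth_concat_uniform:
  assumes "\<And>xs. xs \<in> set xss \<Longrightarrow> length xs = n" and "a < length xss" and "b < n"
  shows "concat xss ! (a * n + b) = xss ! a ! b"
  using assms
proof (induction xss arbitrary: a)
  case (Cons xs xss)
  then show ?case
    by (cases a) (auto simp: nth_append)
qed simp

lemma length_bits_of [simp]: "length (bits_of m t) = m"
  by (simp add: bits_of_def)

lemma length_block [simp]: "length (block m k t) = k * m"
  unfolding block_def by (subst length_concat_uniform[where n = m]) auto

lemma length_counting_cycle: "length (counting_cycle m k) = k * m * 2 ^ (m - 1)"
  unfolding counting_cycle_def by (subst length_concat_uniform[where n = "k * m"]) auto

lemma block_nth:
  assumes "q < k" "i < m"
  shows "block m k t ! (q * m + i) = bit t i"
  unfolding block_def using assms
  by (subst nth_concat_uniform[where n = m]) (auto simp: bits_of_def)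

lemma counting_cycle_nth:
  assumes "t < 2 ^ (m - 1)" "q < k" "i < m"
  shows "counting_cycle m k ! (t * (k * m) + (q * m + i)) = bit t i"
proof -
  have "q * m + i < Suc q * m"
    using assms by simp
  also have "\<dots> \<le> k * m"
    using assms by (intro mult_right_mono) auto
  finally show ?thesis
    unfolding counting_cycle_def using assms
    by (subst nth_concat_uniform[where n = "k * m"]) (auto simp: block_nth)
qed

text \<open>A window at offset \<open>i\<close> meets the last \<open>m - i\<close> bits of one copy
  and the first \<open>i\<close> bits of the next. Only after the last copy of a block does the next
  copy belong to a new block, and the final block is followed by block 0, hence the
  \<open>mod\<close>.\<close>

lemma cyclic_window_counting_cycle:
  assumes t: "t < 2 ^ (m - 1)" and q: "q < k" and i: "i < m"
  defines "t' \<equiv> if Suc q < k then t else Suc t mod 2 ^ (m - 1)"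
  shows "cyclic_window (counting_cycle m k) (q * m + i + t * (k * m)) m =
    map (\<lambda>l. if i + l < m then bit t (i + l) else bit t' (i + l - m)) [0..<m]"
proof -
  let ?N = "2 ^ (m - 1) :: nat" and ?S = "counting_cycle m k"
  have "?S ! ((q * m + i + t * (k * m) + l) mod length ?S) =
      (if i + l < m then bit t (i + l) else bit t' (i + l - m))" if l: "l < m" for l
  proof -
    \<comment> \<open>Such a position lies below the cycle length, so the cyclic reduction does
      nothing.\<close>
    have nth_mod: "?S ! ((u * (k * m) + (p * m + h)) mod length ?S) = bit u h"
      if "u < ?N" "p < k" "h < m" for u p h
    proof -
      have "p * m + h < Suc p * m"
        using that by simp
      also have "\<dots> \<le> k * m"
        using that by (intro mult_right_mono) auto
      finally have "u * (k * m) + (p * m + h) < Suc u * (k * m)"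
        by simp
      also have "\<dots> \<le> ?N * (k * m)"
        using that by (intro mult_right_mono) auto
      finally have "(u * (k * m) + (p * m + h)) mod length ?S = u * (k * m) + (p * m + h)"
        by (simp add: length_counting_cycle mult.commute)
      then show ?thesis
        using that by (simp only: counting_cycle_nth)
    qed
    consider "i + l < m" | "i + l \<ge> m" "Suc q < k" | "i + l \<ge> m" "Suc q = k"
      using q by linarith
    then show ?thesis
    proof cases
      case 1
      then show ?thesis
        using nth_mod[of t q "i + l"] t q by (simp add: algebra_simps)
    next
      case 2
      then have "q * m + i + t * (k * m) + l = t * (k * m) + (Suc q * m + (i + l - m))"
        by simp
      then show ?thesis
        using nth_mod[of t "Suc q" "i + l - m"] 2 t i l by (simp only: t'_def if_True) simp
    next
      case 3
      \<comment> \<open>Reducing the position modulo the length amounts to reducing the block number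
        modulo \<open>?N\<close>.\<close>
      have "(Suc t * (k * m) + (i + l - m)) mod length ?S =
          (Suc t mod ?N * (k * m) + (0 * m + (i + l - m))) mod length ?S"
        unfolding length_counting_cycle
        by (metis (no_types) add_0 mod_add_left_eq mod_mod_trivial mult.commute mult_0 mult_mod_right)
      moreover have "q * m + i + t * (k * m) + l = Suc t * (k * m) + (i + l - m)"
        using 3 by (auto simp: algebra_simps)
      ultimately show ?thesis
        using nth_mod[of "Suc t mod ?N" 0 "i + l - m"] 3 q i l by (simp add: t'_def)
    qed
  qed
  then show ?thesis
    by (simp add: cyclic_window_def)
qed

section \<open>Words with a fixed clear bit as representatives\<close>

text \<open>Complementation swaps the words with bit \<open>c\<close> clear and those with it set,
  so each kind makes up half of all words.\<close>

lemma card_words_with_False: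
  assumes "c < m"
  shows "card {w \<in> binary_words m. \<not> w ! c} = 2 ^ (m - 1)"
proof -
  let ?A = "{w \<in> binary_words m. \<not> w ! c}" and ?B = "{w \<in> binary_words m. w ! c}"
  have words: "binary_words m = {w. set w \<subseteq> (UNIV :: bool set) \<and> length w = m}"
    by (simp add: binary_words_def)
  have fin: "finite (binary_words m)"
    unfolding words by (rule finite_lists_length_eq) simp
  have "card ?A = card ?B"
  proof (rule bij_betw_same_card)
    show "bij_betw bitwise_complement ?A ?B"
      using assms
      by (intro bij_betw_byWitness[where f' = bitwise_complement])
        (auto simp: bitwise_complement_def binary_words_def comp_def)
  qed
  moreover have "card (binary_words m) = card ?A + card ?B"
    using fin by (subst card_Un_disjoint[symmetric]) (auto intro: arg_cong[where f = card])
  moreover have "card (binary_words m) = 2 ^ m"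
    unfolding words by (subst card_lists_length_eq) auto
  moreover have "(2::nat) ^ m = 2 * 2 ^ (m - 1)"
    using assms by (cases m) auto
  ultimately show ?thesis
    by simp
qed

lemma unlabeled_representatives_False_at:
  assumes "c < m"
  shows "unlabeled_representatives m {w \<in> binary_words m. \<not> w ! c}"
proof -
  have "{w \<in> binary_words m. \<not> w ! c} \<inter> {w, bitwise_complement w} =
      {if w ! c then bitwise_complement w else w}" if "w \<in> binary_words m" for w
    using assms that by (auto simp: binary_words_def bitwise_complement_def)
  then show ?thesis
    by (auto simp: unlabeled_representatives_def)
qed

text \<open>Recovers the low bits of \<open>t\<close> from those of \<open>t + 1\<close> for windows
  that run into the next block.\<close>

lemma Suc_mod_cancel:
  fixes a b n :: nat
  assumes "Suc a mod n = Suc b mod n"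
  shows "a mod n = b mod n"
  using assms by (metis mod_Suc Suc_inject old.nat.distinct(2))

lemma multiversal_counting_cycle:
  assumes m: "1 \<le> m"
  shows "multiversal_cycle m (k * m) (counting_cycle m k)"
proof -
  let ?N = "2 ^ (m - 1) :: nat" and ?S = "counting_cycle m k"
  have "unlabeled_representatives m
      ((\<lambda>t. cyclic_window ?S (j + t * (k * m)) m) ` {t. t < ?N})" if j: "j < k * m" for j
  proof -
    define q i where "q = j div m" and "i = j mod m"
    have j_eq: "j = q * m + i" and i: "i < m"
      using m by (simp_all add: q_def i_def)
    have q: "q < k"
      using j m by (simp add: q_def less_mult_imp_div_less)
    define t' where "t' t = (if Suc q < k then t else Suc t mod ?N)" for t
    define W where
      "W t = map (\<lambda>l. if i + l < m then bit t (i + l) else bit (t' t) (i + l - m)) [0..<m]" for t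
    let ?A = "{w \<in> binary_words m. \<not> w ! (m - 1 - i)}"
    have high: "\<not> bit t n" if "t < ?N" "m - 1 \<le> n" for t n
    proof -
      have "t < 2 ^ n"
        using that by (meson order_less_le_trans one_le_numeral power_increasing)
      then show ?thesis
        by (simp add: bit_iff_odd)
    qed
    \<comment> \<open>As \<open>i \<le> m - 1\<close>, the wrap modulo \<open>?N\<close> does not
      alter the \<open>i\<close> low bits of \<open>Suc t\<close>.\<close>
    have dvd: "2 ^ i dvd ?N"
      using i by (intro le_imp_power_dvd) simp
    \<comment> \<open>Injectivity suffices: the \<open>?N\<close> windows lie in \<open>?A\<close>,
      which has just \<open>?N\<close> elements.\<close>
    have "inj_on W {t. t < ?N}"
    proof (rule inj_onI)
      fix t u
      assume tu: "t \<in> {t. t < ?N}" "u \<in> {t. t < ?N}" and eq: "W t = W u"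
      have nth_eq: "W t ! l = W u ! l" for l
        by (simp add: eq)
      \<comment> \<open>Window position \<open>n\<close> shows bit \<open>i + n\<close> as long as
        \<open>i + n < m\<close>; the bits beyond vanish by \<open>high\<close>.\<close>
      have "t div 2 ^ i = u div 2 ^ i"
      proof (rule bit_eqI)
        fix n
        show "bit (t div 2 ^ i) n = bit (u div 2 ^ i) n"
          using nth_eq[of n] high[of t "i + n"] high[of u "i + n"] tu
          by (cases "i + n < m") (auto simp: W_def bit_simps simp flip: drop_bit_eq_div)
      qed
      moreover have "t' t mod 2 ^ i = t' u mod 2 ^ i"
      proof (rule bit_eqI)
        fix n
        show "bit (t' t mod 2 ^ i) n = bit (t' u mod 2 ^ i) n"
          using nth_eq[of "n + m - i"] i
          by (cases "n < i") (auto simp: W_def bit_simps simp flip: take_bit_eq_mod)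
      qed
      \<comment> \<open>\<open>q\<close> is fixed, so \<open>t'\<close> is the identity for both
        numbers or the successor modulo \<open>?N\<close> for both.\<close>
      then have "t mod 2 ^ i = u mod 2 ^ i"
        using dvd by (auto simp: t'_def mod_mod_cancel intro: Suc_mod_cancel split: if_splits)
      ultimately show "t = u"
        by (metis div_mult_mod_eq)
    qed
    then have "card (W ` {t. t < ?N}) = card ?A"
      using card_words_with_False[of "m - 1 - i" m] i by (simp add: card_image)
    moreover have "W ` {t. t < ?N} \<subseteq> ?A"
      using high i by (auto simp: W_def binary_words_def)
    moreover have "finite ?A"
      using card_words_with_False[of "m - 1 - i" m] i by (intro card_ge_0_finite) simp
    ultimately have "W ` {t. t < ?N} = ?A"
      by (intro card_subset_eq)
    moreover have "(\<lambda>t. cyclic_window ?S (j + t * (k * m)) m) ` {t. t < ?N} = W ` {t. t < ?N}"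
      by (intro image_cong refl)
        (simp add: W_def t'_def j_eq cyclic_window_counting_cycle[OF _ q i])
    ultimately show ?thesis
      using unlabeled_representatives_False_at[of "m - 1 - i" m] i by simp
  qed
  then show ?thesis
    by (simp add: multiversal_cycle_def length_counting_cycle)
qed

section \<open>The generator\<close>

definition runs_within :: "program \<Rightarrow> nat \<Rightarrow> configuration \<Rightarrow> configuration \<Rightarrow> bool" where
  "runs_within P B c c' \<longleftrightarrow> (\<exists>T \<le> B. (step P ^^ T) c c')"

lemma runs_within_trans:
  assumes "runs_within P A c c'" "runs_within P B c' c''"
  shows "runs_within P (A + B) c c''"
proof -
  obtain T U where "T \<le> A" "U \<le> B" "(step P ^^ T) c c'" "(step P ^^ U) c' c''"
    using assms by (auto simp: runs_within_def)
  then show ?thesis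
    unfolding runs_within_def by (intro exI[of _ "T + U"]) (auto simp: relpowp_add)
qed

lemma runs_within_mono: "runs_within P A c c' \<Longrightarrow> A \<le> B \<Longrightarrow> runs_within P B c c'"
  by (meson runs_within_def order_trans)

lemma runs_within_relpowp: "(step P ^^ n) c c' \<Longrightarrow> runs_within P n c c'"
  by (auto simp: runs_within_def)

text \<open>Lets the simplifier run the program symbolically, peeling one instruction at a time off
  a numeral step count.\<close>

lemma relpowp_step_numeral:
  "(step P ^^ numeral n) (pc, R, out) c' \<longleftrightarrow>
     pc < length P \<and> (step P ^^ pred_numeral n) (execute (P ! pc) (pc, R, out)) c'"
proof -
  have "(step P ^^ Suc l) (pc, R, out) c' \<longleftrightarrow>
      pc < length P \<and> (step P ^^ l) (execute (P ! pc) (pc, R, out)) c'" for l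
    by (auto simp: relpowp_Suc_left OO_def step_def halted_def simp del: relpowp.simps)
  then show ?thesis
    by (simp only: numeral_eq_Suc)
qed

text \<open>
  Register 0 holds \<open>m\<close>, register 1 holds \<open>k\<close>, register 2 the constant 1 and register 7 the constant 0;
  the counter occupies the registers from 8 on.  Addresses: 1 starts a block, 2 a copy of the word,
  6 a bit, 12 the increment, 13 a carry step, and 18 sets the lowest clear bit and then tests whether
  this was the top bit.
\<close>

definition generator :: program where
  "generator =
    [Const 2 1,
     Add 3 1 7,
     JumpZero 3 12,
     Sub 3 3 2,
     Const 4 8,
     Add 5 0 7,
     JumpZero 5 2,
     Sub 5 5 2,
     Load 6 4,
     Write 6,
     Add 4 4 2,
     JumpZero 7 6,
     Const 4 8,
     Load 6 4,
     JumpZero 6 18,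
     Store 4 7,
     Add 4 4 2,
     JumpZero 7 13,
     Store 4 2,
     Const 5 7,
     Add 5 0 5,
     Sub 5 5 4,
     JumpZero 5 24,
     JumpZero 7 1]"

lemma length_generator [simp]: "length generator = 24"
  by (simp add: generator_def)

lemma generator_nth:
  "generator ! 0 = Const 2 1"
  "generator ! Suc 0 = Add 3 1 7"
  "generator ! 2 = JumpZero 3 12"
  "generator ! 3 = Sub 3 3 2"
  "generator ! 4 = Const 4 8"
  "generator ! 5 = Add 5 0 7"
  "generator ! 6 = JumpZero 5 2"
  "generator ! 7 = Sub 5 5 2"
  "generator ! 8 = Load 6 4"
  "generator ! 9 = Write 6"
  "generator ! 10 = Add 4 4 2"
  "generator ! 11 = JumpZero 7 6"
  "generator ! 12 = Const 4 8"
  "generator ! 13 = Load 6 4"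
  "generator ! 14 = JumpZero 6 18"
  "generator ! 15 = Store 4 7"
  "generator ! 16 = Add 4 4 2"
  "generator ! 17 = JumpZero 7 13"
  "generator ! 18 = Store 4 2"
  "generator ! 19 = Const 5 7"
  "generator ! 20 = Add 5 0 5"
  "generator ! 21 = Sub 5 5 4"
  "generator ! 22 = JumpZero 5 24"
  "generator ! 23 = JumpZero 7 1"
  by (simp_all add: generator_def)

lemmas generator_run = generator_nth relpowp_step_numeral eq_OO step_def halted_def

text \<open>With register 7 zero, \<open>JumpZero 7 l\<close> is an unconditional jump and
  \<open>Add d a 7\<close> copies a register. Registers 3 to 6 are work space.\<close>

definition constants :: "nat \<Rightarrow> nat \<Rightarrow> (nat \<Rightarrow> nat) \<Rightarrow> bool" where
  "constants m k R \<longleftrightarrow> R 0 = m \<and> R 1 = k \<and> R 2 = 1 \<and> R 7 = 0"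

text \<open>Having \<open>m\<close> bits, the counter can also hold the final value
  \<open>2 ^ (m - 1)\<close>, whose top bit signals the end.\<close>

definition counter :: "nat \<Rightarrow> nat \<Rightarrow> (nat \<Rightarrow> nat) \<Rightarrow> bool" where
  "counter m t R \<longleftrightarrow> (\<forall>i < m. R (8 + i) = of_bool (bit t i))"

section \<open>Writing the copies of a word\<close>

text \<open>Each bit costs the six instructions from address 6 on, and leaving the loop costs one
  test. The bound \<open>8 \<le> R 4\<close> keeps the bits still to be read apart from the work
  registers.\<close>

lemma write_bits:
  assumes "constants m k R" "8 \<le> R 4" "R 5 = n"
  shows "\<exists>R'. runs_within generator (6 * n + 1) (6, R, out)
           (2, R', out @ map R [R 4..<R 4 + n]) \<and> (\<forall>r. r \<notin> {4, 5, 6} \<longrightarrow> R' r = R r)"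
  using assms
proof (induction n arbitrary: R out)
  case 0
  then have "runs_within generator 1 (6, R, out) (2, R, out)"
    by (intro runs_within_relpowp) (simp add: generator_run)
  then show ?case
    by auto
next
  case (Suc n)
  define R1 where "R1 = R(5 := n, 6 := R (R 4), 4 := Suc (R 4))"
  have "map R1 [R1 4..<R1 4 + n] = map R [Suc (R 4)..<Suc (R 4) + n]"
    using Suc.prems by (auto simp: R1_def)
  then have out: "(out @ [R (R 4)]) @ map R1 [R1 4..<R1 4 + n] = out @ map R [R 4..<R 4 + Suc n]"
    by (simp add: R1_def upt_conv_Cons del: upt_Suc)
  have "constants m k R1" "8 \<le> R1 4" "R1 5 = n"
    using Suc.prems by (simp_all add: R1_def constants_def)
  then obtain R' where R': "runs_within generator (6 * n + 1) (6, R1, out @ [R (R 4)])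
      (2, R', out @ map R [R 4..<R 4 + Suc n])" "\<forall>r. r \<notin> {4, 5, 6} \<longrightarrow> R' r = R1 r"
    using Suc.IH[of R1 "out @ [R (R 4)]", unfolded out] by blast
  have "(step generator ^^ 6) (6, R, out) (6, R1, out @ [R (R 4)])"
    using Suc.prems by (simp add: R1_def generator_run constants_def)
  from runs_within_trans[OF runs_within_relpowp[OF this] R'(1)]
  have "runs_within generator (6 * Suc n + 1) (6, R, out) (2, R', out @ map R [R 4..<R 4 + Suc n])"
    by (rule runs_within_mono) simp
  then show ?case
    using R'(2) by (intro exI[of _ R']) (auto simp: R1_def)
qed

lemma map_counter:
  assumes "counter m t R"
  shows "map R [8..<8 + m] = map of_bool (bits_of m t)"
  using assms by (intro nth_equalityI) (auto simp: counter_def bits_of_def)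

text \<open>A copy costs 4 steps of setup and \<open>6 * m + 1\<close> for its bits; the last step
  is the failing test for another copy.\<close>

lemma write_copies:
  assumes "constants m k R" "counter m t R" "R 3 = c"
  shows "\<exists>R'. runs_within generator (c * (6 * m + 5) + 1) (2, R, out)
           (12, R', out @ map of_bool (block m c t)) \<and> constants m k R' \<and> counter m t R'"
  using assms
proof (induction c arbitrary: R out)
  case 0
  then have "runs_within generator 1 (2, R, out) (12, R, out)"
    by (intro runs_within_relpowp) (simp add: generator_run)
  then show ?case
    using 0 by (auto simp: block_def)
next
  case (Suc c)
  let ?R = "R(3 := c, 4 := 8, 5 := m)" and ?out = "out @ map of_bool (bits_of m t)"
  have "constants m k ?R" "counter m t ?R"
    using Suc.prems by (auto simp: constants_def counter_def)
  then obtain R1 where R1: "runs_within generator (6 * m + 1) (6, ?R, out) (2, R1, ?out)"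
      "\<forall>r. r \<notin> {4, 5, 6} \<longrightarrow> R1 r = ?R r"
    using write_bits[of m k ?R m out] map_counter[of m t ?R] by auto
  have "constants m k R1" "counter m t R1" "R1 3 = c"
    using R1(2) Suc.prems by (auto simp: constants_def counter_def)
  then obtain R2 where R2: "runs_within generator (c * (6 * m + 5) + 1) (2, R1, ?out)
      (12, R2, ?out @ map of_bool (block m c t))" "constants m k R2" "counter m t R2"
    using Suc.IH by blast
  have "(step generator ^^ 4) (2, R, out) (6, ?R, out)"
    using Suc.prems by (simp add: generator_run constants_def)
  from runs_within_trans[OF runs_within_trans[OF runs_within_relpowp[OF this] R1(1)] R2(1)]
  have "runs_within generator (Suc c * (6 * m + 5) + 1) (2, R, out)
      (12, R2, ?out @ map of_bool (block m c t))"
    by (rule runs_within_mono) simp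
  then show ?case
    using R2 by (auto simp: block_def)
qed

section \<open>Incrementing the counter\<close>

text \<open>
  The carry invariant: the bits below \<open>j\<close> are already those of \<open>t + 1\<close>, and a carry enters bit \<open>j\<close>.
\<close>

lemma increment_stop:
  assumes "constants m k R" "R 4 = 8 + j" "j < m" "\<not> bit t j"
    and "\<And>i. i < m \<Longrightarrow> R (8 + i) = of_bool (bit (if i < j then Suc t else t) i)"
    and "Suc t div 2 ^ j = Suc (t div 2 ^ j)"
  shows "\<exists>R' j'. runs_within generator 3 (13, R, out) (19, R', out) \<and>
           constants m k R' \<and> counter m (Suc t) R' \<and> R' 4 = 8 + j' \<and> j' < m \<and> bit (Suc t) j'"
proof -
  let ?R = "R(6 := 0, 8 + j := 1)"
  \<comment> \<open>The last assumption is the entering carry. Added to the even number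
    \<open>t div 2 ^ j\<close>, it sets bit \<open>j\<close> and leaves the half unchanged, hence
    all higher bits.\<close>
  have even: "even (t div 2 ^ j)" and set: "bit (Suc t) j"
    using assms(4,6) by (simp_all add: bit_iff_odd)
  have above: "bit (Suc t) i = bit t i" if "j < i" for i
  proof -
    have i: "(2::nat) ^ i = 2 ^ j * 2 * 2 ^ (i - Suc j)"
      using that by (simp flip: power_Suc power_Suc2 power_add)
    have "Suc t div 2 ^ i = t div 2 ^ i"
      unfolding i div_mult2_eq assms(6) using even by simp
    then show ?thesis
      by (simp add: bit_iff_odd)
  qed
  have "R (8 + j) = 0"
    using assms by simp
  then have "runs_within generator 3 (13, R, out) (19, ?R, out)"
    using assms by (intro runs_within_relpowp) (simp add: generator_run constants_def)
  moreover have "counter m (Suc t) ?R"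
    unfolding counter_def
  proof (intro allI impI)
    fix i
    assume "i < m"
    then show "?R (8 + i) = of_bool (bit (Suc t) i)"
      using assms(5)[of i] set above by (cases i j rule: linorder_cases) auto
  qed
  ultimately show ?thesis
    using assms set by (intro exI[of _ ?R] exI[of _ j]) (auto simp: constants_def)
qed

text \<open>The clear bit at \<open>j + n\<close> bounds the distance that the carry can travel.\<close>

lemma increment:
  assumes "constants m k R" "R 4 = 8 + j" "j + n < m" "\<not> bit t (j + n)"
    and "\<And>i. i < m \<Longrightarrow> R (8 + i) = of_bool (bit (if i < j then Suc t else t) i)"
    and "Suc t div 2 ^ j = Suc (t div 2 ^ j)"
  shows "\<exists>R' j'. runs_within generator (5 * n + 3) (13, R, out) (19, R', out) \<and>
           constants m k R' \<and> counter m (Suc t) R' \<and> R' 4 = 8 + j' \<and> j' < m \<and> bit (Suc t) j'"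
  using assms
proof (induction n arbitrary: R j)
  case (0 R j)
  show ?case
    using increment_stop[of m k R j t out] 0 by simp
next
  case (Suc n R j)
  show ?case
  proof (cases "bit t j")
    case False
    \<comment> \<open>The clear bit at distance \<open>Suc n\<close> need not be the first one; here
      the carry stops at once, well within the bound.\<close>
    have "runs_within generator 3 c c' \<Longrightarrow> runs_within generator (5 * Suc n + 3) c c'" for c c'
      by (rule runs_within_mono) auto
    moreover have "\<exists>R' j'. runs_within generator 3 (13, R, out) (19, R', out) \<and>
        constants m k R' \<and> counter m (Suc t) R' \<and> R' 4 = 8 + j' \<and> j' < m \<and> bit (Suc t) j'"
      using Suc.prems False by (intro increment_stop) auto
    ultimately show ?thesis
      by blast
  next
    case True
    let ?R = "R(6 := 1, 8 + j := 0, 4 := 8 + Suc j)"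
    \<comment> \<open>Adding the carry to an odd number clears its low bit and passes a carry on to
      bit \<open>Suc j\<close>.\<close>
    have odd: "odd (t div 2 ^ j)" and clear: "\<not> bit (Suc t) j"
      using True Suc.prems(6) by (simp_all add: bit_iff_odd)
    have "Suc t div 2 ^ Suc j = Suc (t div 2 ^ j) div 2"
      using Suc.prems(6) by (metis div_mult2_eq power_Suc2)
    also have "\<dots> = Suc (t div 2 ^ j div 2)"
      using odd by simp
    also have "\<dots> = Suc (t div 2 ^ Suc j)"
      by (metis div_mult2_eq power_Suc2)
    finally have carry: "Suc t div 2 ^ Suc j = Suc (t div 2 ^ Suc j)" .
    have R: "R (8 + j) = 1"
      using Suc.prems True by simp
    have "\<exists>R' j'. runs_within generator (5 * n + 3) (13, ?R, out) (19, R', out) \<and>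
        constants m k R' \<and> counter m (Suc t) R' \<and> R' 4 = 8 + j' \<and> j' < m \<and> bit (Suc t) j'"
    proof (rule Suc.IH[OF _ _ _ _ _ carry])
      show "?R (8 + i) = of_bool (bit (if i < Suc j then Suc t else t) i)" if "i < m" for i
        using Suc.prems(5)[OF that] clear by (auto simp: less_Suc_eq)
    qed (use Suc.prems in \<open>auto simp: constants_def\<close>)
    then obtain R' j' where R': "runs_within generator (5 * n + 3) (13, ?R, out) (19, R', out)"
        "constants m k R'" "counter m (Suc t) R'" "R' 4 = 8 + j'" "j' < m" "bit (Suc t) j'"
      by blast
    have "(step generator ^^ 5) (13, R, out) (13, ?R, out)"
      using Suc.prems R by (simp add: generator_run constants_def)
    from runs_within_trans[OF runs_within_relpowp[OF this] R'(1)]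
    have "runs_within generator (5 * Suc n + 3) (13, R, out) (19, R', out)"
      by (rule runs_within_mono) simp
    then show ?thesis
      using R' by blast
  qed
qed

section \<open>Assembling the blocks\<close>

lemma generate_block:
  assumes "constants m k R" "counter m t R" "t < 2 ^ (m - 1)" "1 \<le> m" "1 \<le> k"
  shows "\<exists>R'. runs_within generator (27 * (k * m)) (1, R, out)
           (if Suc t = 2 ^ (m - 1) then 24 else 1, R', out @ map of_bool (block m k t)) \<and>
           constants m k R' \<and> counter m (Suc t) R'"
proof -
  let ?out = "out @ map of_bool (block m k t)"
  have "constants m k (R(3 := k))" "counter m t (R(3 := k))"
    using assms by (auto simp: constants_def counter_def)
  then obtain R1 where R1: "runs_within generator (k * (6 * m + 5) + 1) (2, R(3 := k), out)
      (12, R1, ?out)" "constants m k R1" "counter m t R1"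
    using write_copies[of m k "R(3 := k)" t k out] by auto
  have "(step generator ^^ 1) (1, R, out) (2, R(3 := k), out)"
    using assms by (simp add: generator_run constants_def numeral_2_eq_2)
  note 1 = runs_within_trans[OF runs_within_relpowp[OF this] R1(1)]
  \<comment> \<open>Bit \<open>m - 1\<close> of \<open>t\<close> is clear, so from bit 0 the carry
    travels at most \<open>m - 1\<close> places.\<close>
  have "\<exists>R' j'. runs_within generator (5 * (m - 1) + 3) (13, R1(4 := 8), ?out) (19, R', ?out) \<and>
      constants m k R' \<and> counter m (Suc t) R' \<and> R' 4 = 8 + j' \<and> j' < m \<and> bit (Suc t) j'"
    by (rule increment[where j = 0])
      (use assms R1 in \<open>auto simp: constants_def counter_def bit_iff_odd\<close>)
  then obtain R2 j where R2: "runs_within generator (5 * (m - 1) + 3) (13, R1(4 := 8), ?out) (19, R2, ?out)"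
      "constants m k R2" "counter m (Suc t) R2" "R2 4 = 8 + j" "j < m" "bit (Suc t) j"
    by blast
  have "(step generator ^^ 1) (12, R1, ?out) (13, R1(4 := 8), ?out)"
    by (simp add: generator_run)
  note 2 = runs_within_trans[OF runs_within_relpowp[OF this] R2(1)]
  let ?R = "R2(5 := m - 1 - j)"
  \<comment> \<open>The program computes this difference as \<open>(m + 7) - (8 + j)\<close>. As
    \<open>Suc t \<le> 2 ^ (m - 1)\<close>, its bit \<open>m - 1\<close> is set only in the case of
    equality, and then no other bit is.\<close>
  have top: "m - 1 - j = 0 \<longleftrightarrow> Suc t = 2 ^ (m - 1)"
  proof
    assume "m - 1 - j = 0"
    then have "j = m - 1"
      using R2(5) by simp
    then have "2 ^ (m - 1) \<le> Suc t"
      using R2(6) by (metis bit_iff_odd div_less even_zero not_le)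
    then show "Suc t = 2 ^ (m - 1)"
      using assms by simp
  next
    assume "Suc t = 2 ^ (m - 1)"
    then show "m - 1 - j = 0"
      using R2(6) by (simp add: bit_simps)
  qed
  have "runs_within generator 5 (19, R2, ?out) (if Suc t = 2 ^ (m - 1) then 24 else 1, ?R, ?out)"
  proof (cases "m - 1 - j = 0")
    case True
    then have "(step generator ^^ 4) (19, R2, ?out) (24, ?R, ?out)"
      using R2 by (simp add: generator_run constants_def)
    then show ?thesis
      using True top by (auto intro: runs_within_relpowp runs_within_mono)
  next
    case False
    then have "(step generator ^^ 5) (19, R2, ?out) (1, ?R, ?out)"
      using R2 by (simp add: generator_run constants_def)
    then show ?thesis
      using False top by (auto intro: runs_within_relpowp)
  qed
  note runs_within_trans[OF runs_within_trans[OF 1 2] this]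
  \<comment> \<open>Replacing \<open>m - 1\<close> by \<open>m\<close> gives at most
    \<open>6 * (k * m) + 5 * k + 5 * m + 11\<close>, and 6 + 5 + 5 + 11 = 27.\<close>
  moreover have "1 + (k * (6 * m + 5) + 1) + (1 + (5 * (m - 1) + 3)) + 5 \<le> 27 * (k * m)"
  proof -
    have "k \<le> k * m" "m \<le> k * m" "1 \<le> k * m"
      using assms by simp_all
    moreover have "k * (6 * m + 5) = 6 * (k * m) + 5 * k"
      by (simp add: algebra_simps)
    ultimately show ?thesis
      by linarith
  qed
  moreover have "constants m k ?R" "counter m (Suc t) ?R"
    using R2 by (auto simp: constants_def counter_def)
  ultimately show ?thesis
    by (blast intro: runs_within_mono)
qed

text \<open>\<open>n\<close> counts the blocks after the current one, since the machine tests for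
  the end only after writing a block.\<close>

lemma generate_blocks:
  assumes "constants m k R" "counter m t R" "t + Suc n = 2 ^ (m - 1)" "1 \<le> m" "1 \<le> k"
  shows "\<exists>R'. runs_within generator (27 * (k * m) * Suc n) (1, R, out)
           (24, R', out @ map of_bool (concat (map (block m k) [t..<2 ^ (m - 1)])))"
  using assms
proof (induction n arbitrary: R t out)
  case 0
  then have "Suc t = 2 ^ (m - 1)"
    by simp
  moreover from this have "[t..<2 ^ (m - 1)] = [t]"
    by (metis upt_conv_Cons lessI upt_rec less_irrefl)
  ultimately show ?case
    using generate_block[of m k R t out] 0 by auto
next
  case (Suc n)
  let ?out = "out @ map of_bool (block m k t)"
  have t: "t < 2 ^ (m - 1)" "Suc t \<noteq> 2 ^ (m - 1)"
    using Suc.prems(3) by linarith+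
  then obtain R1 where R1: "runs_within generator (27 * (k * m)) (1, R, out) (1, R1, ?out)"
      "constants m k R1" "counter m (Suc t) R1"
    using generate_block[of m k R t out] Suc.prems by auto
  then obtain R2 where "runs_within generator (27 * (k * m) * Suc n) (1, R1, ?out)
      (24, R2, ?out @ map of_bool (concat (map (block m k) [Suc t..<2 ^ (m - 1)])))"
    using Suc.IH[of R1 "Suc t" ?out] Suc.prems by auto
  from runs_within_trans[OF R1(1) this]
  have "runs_within generator (27 * (k * m) * Suc (Suc n)) (1, R, out)
      (24, R2, out @ map of_bool (concat (map (block m k) [t..<2 ^ (m - 1)])))"
    using t by (simp add: upt_conv_Cons algebra_simps)
  then show ?case
    by blast
qed

lemma generates_counting_cycle:
  assumes "1 \<le> m" "1 \<le> k"
  shows "\<exists>T. generates_in generator [m, k] (counting_cycle m k) T \<and>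
           T \<le> 28 * length (counting_cycle m k)"
proof -
  let ?S = "counting_cycle m k"
  define R :: "nat \<Rightarrow> nat" where "R = (\<lambda>i. if i < 2 then [m, k] ! i else 0)"
  \<comment> \<open>All registers beyond the two inputs start at 0, so the counter and register 7
    need no initialization.\<close>
  have "constants m k (R(2 := 1))" "counter m 0 (R(2 := 1))"
    by (auto simp: R_def constants_def counter_def)
  moreover have "0 + Suc (2 ^ (m - 1) - 1) = 2 ^ (m - 1)"
    by simp
  ultimately obtain R' where
    "runs_within generator (27 * (k * m) * 2 ^ (m - 1)) (1, R(2 := 1), []) (24, R', map of_bool ?S)"
    using generate_blocks[of m k "R(2 := 1)" 0 "2 ^ (m - 1) - 1" "[]"] assms
    by (auto simp: counting_cycle_def)
  moreover have "(step generator ^^ 1) (0, R, []) (1, R(2 := 1), [])"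
    by (simp add: generator_run)
  ultimately have "runs_within generator (1 + 27 * (k * m) * 2 ^ (m - 1)) (0, R, []) (24, R', map of_bool ?S)"
    by (blast intro: runs_within_trans runs_within_relpowp)
  moreover have "initial [m, k] = (0, R, [])"
    by (simp add: initial_def R_def numeral_2_eq_2)
  ultimately obtain T where "T \<le> 1 + 27 * (k * m) * 2 ^ (m - 1)"
      "(step generator ^^ T) (initial [m, k]) (24, R', map of_bool ?S)"
    by (auto simp: runs_within_def)
  \<comment> \<open>The cycle is nonempty, so the single setup step raises the constant from 27 to
    28 only.\<close>
  moreover have "1 \<le> k * m * 2 ^ (m - 1)"
    using assms by simp
  then have "1 + 27 * (k * m) * 2 ^ (m - 1) \<le> 28 * (k * m * 2 ^ (m - 1))"
    by linarith
  ultimately show ?thesis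
    unfolding generates_in_def computes_in_def
    by (intro exI[of _ T]) (auto simp: halted_def length_counting_cycle intro: order_trans)
qed

theorem theorem16:
  "\<exists>(P :: program) (C :: nat). \<forall>(m :: nat) (k :: nat). 1 \<le> m \<longrightarrow> 1 \<le> k \<longrightarrow>
     (\<exists>(S :: bool list) (T :: nat).
        multiversal_cycle m (k * m) S \<and>
        generates_in P [m, k] S T \<and>
        T \<le> C * length S)"
  using multiversal_counting_cycle generates_counting_cycle by blast

end
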